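(* For all but finitely many positive integers $n$, $$\mathrm{AMN}(P_n)-1\le\mathrm{SMN}'(P_n)\le\mathrm{SMN}(P_n)\le\mathrm{AMN}(P_n).$$
   Context: $P_n$ denotes the powerset class: the concept class of all $2^n$ functions $c:X\to\{0,1\}$ over a domain $X=\{x_1,\ldots,x_n\}$ of size $n$. For a finite set $X$ and a nonempty family (concept class) $C$ of functions $c:X\to\{0,1\}$ (concepts): a labeled sample of size $m\ge 0$ is a set $S=\{(x_1,b_1),\ldots,(x_m,b_m)\}\subseteq X\times\{0,1\}$ with $x_1,\ldots,x_m$ distinct; $|S|=m$ (the empty sample is allowed). A concept $c$ is consistent with $S$ if $c(x_i)=b_i$ for all $i$. $S$ is $C$-realizable if some $c\in C$ is consistent with $S$. A $C$-saturating matching is a map $M$ assigning to each $c\in C$ a labeled sample $M(c)$ with which $c$ is consistent, such that $M(c)\ne M(c')$ whenever $c\neq c'$ in $C$. Its cost is $\max_{c\in C}|M(c)|$. It has the antichain property if $M(c)\not\subseteq M(c')$ for all distinct $c,c'\in C$. - $\mathrm{SMN}(C)$: the smallest cost of a $C$-saturating matching. - $\mathrm{SMN}'(C)$: the smallest $d$ such that the number of $C$-realizable samples of size at most $d$ is at least $|C|$. - $\mathrm{AMN}(C)$: the smallest cost of a $C$-saturating matching having the antichain property. *)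

theory Defs
  imports "HOL-Library.FuncSet"
begin

text \<open>A concept over the finite domain \<open>X\<close> is an element of \<open>X \<rightarrow>\<^sub>E UNIV\<close>: a boolean-valued
  function that is fixed to \<open>undefined\<close> outside \<open>X\<close>, so that concepts which agree on \<open>X\<close> are equal.
  The labels 0 and 1 are \<open>False\<close> and \<open>True\<close>.\<close>

type_synonym 'a concept = "'a \<Rightarrow> bool"
type_synonym 'a sample = "('a \<times> bool) set"

text \<open>Injectivity of \<open>fst\<close> says that the points occurring in the sample are distinct, that is,
  no point carries both labels.\<close>

definition labeled_samples :: "'a set \<Rightarrow> 'a sample set" where
  "labeled_samples X = {S. finite S \<and> S \<subseteq> X \<times> UNIV \<and> inj_on fst S}"

definition consistent :: "'a concept \<Rightarrow> 'a sample \<Rightarrow> bool" where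
  "consistent c S \<longleftrightarrow> (\<forall>(x, b)\<in>S. c x = b)"

definition realizable :: "'a concept set \<Rightarrow> 'a sample \<Rightarrow> bool" where
  "realizable C S \<longleftrightarrow> (\<exists>c\<in>C. consistent c S)"

definition saturating_matching ::
  "'a set \<Rightarrow> 'a concept set \<Rightarrow> ('a concept \<Rightarrow> 'a sample) \<Rightarrow> bool" where
  "saturating_matching X C M \<longleftrightarrow>
     (\<forall>c\<in>C. M c \<in> labeled_samples X \<and> consistent c (M c)) \<and> inj_on M C"

definition cost :: "'a concept set \<Rightarrow> ('a concept \<Rightarrow> 'a sample) \<Rightarrow> nat" where
  "cost C M = Max ((\<lambda>c. card (M c)) ` C)"

definition antichain_property :: "'a concept set \<Rightarrow> ('a concept \<Rightarrow> 'a sample) \<Rightarrow> bool" where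
  "antichain_property C M \<longleftrightarrow> (\<forall>c\<in>C. \<forall>c'\<in>C. c \<noteq> c' \<longrightarrow> \<not> M c \<subseteq> M c')"

text \<open>For a finite domain \<open>X\<close> and a nonempty class \<open>C \<subseteq> X \<rightarrow>\<^sub>E UNIV\<close> the minima below exist, since
  each concept can be matched with its full graph over \<open>X\<close>.\<close>

definition SMN :: "'a set \<Rightarrow> 'a concept set \<Rightarrow> nat" where
  "SMN X C = (LEAST d. \<exists>M. saturating_matching X C M \<and> cost C M = d)"

definition SMN' :: "'a set \<Rightarrow> 'a concept set \<Rightarrow> nat" where
  "SMN' X C =
     (LEAST d. card C \<le> card {S \<in> labeled_samples X. realizable C S \<and> card S \<le> d})"

definition AMN :: "'a set \<Rightarrow> 'a concept set \<Rightarrow> nat" where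
  "AMN X C =
     (LEAST d. \<exists>M. saturating_matching X C M \<and> antichain_property C M \<and> cost C M = d)"

definition powerset_class :: "'a set \<Rightarrow> 'a concept set" where
  "powerset_class X = X \<rightarrow>\<^sub>E UNIV"

end

theory Submission
  imports Defs
begin

text \<open>All samples of one fixed size \<open>k\<close> form an antichain, and containment between concepts on
  \<open>n\<close> points and samples of size \<open>k\<close> is a biregular bipartite graph with degrees \<open>n choose k\<close> and
  \<open>2 ^ (n - k)\<close>. So by Hall's theorem there is an antichain matching of cost \<open>k\<close> as soon as
  \<open>2 ^ n \<le> (n choose k) * 2 ^ k\<close>. As long as \<open>i < n / 2\<close>, the number \<open>(n choose i) * 2 ^ i\<close> of
  samples of size \<open>i\<close> at least doubles from \<open>i\<close> to \<open>i + 1\<close>; hence the samples of size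
  \<open>d + 1\<close> outnumber those of size at most \<open>d\<close>, and for \<open>d = SMN'\<close> they are at least \<open>2 ^ n\<close> in number.\<close>

section \<open>Hall's theorem\<close>

text \<open>Induction on \<open>I\<close> in the manner of Halmos and Vaughan. If some nonempty
  proper \<open>J\<close> is tight, that is, has exactly as many neighbours as elements, then
  \<open>J\<close> is matched into its neighbourhood \<open>U\<close> and \<open>I - J\<close>
  outside \<open>U\<close>. If every nonempty proper subset has a neighbour to spare, any
  \<open>i\<close> may take any \<open>x\<close> in \<open>A i\<close>, and the rest is matched
  without \<open>x\<close>.\<close>

theorem Hall:
  assumes "finite I" and "\<And>i. i \<in> I \<Longrightarrow> finite (A i)"
    and "\<And>J. J \<subseteq> I \<Longrightarrow> card J \<le> card (\<Union>(A ` J))"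
  shows "\<exists>f. inj_on f I \<and> (\<forall>i\<in>I. f i \<in> A i)"
  using assms
proof (induction I arbitrary: A rule: finite_psubset_induct)
  case (psubset I)
  have fin_Un: "finite (\<Union>(A ` J))" if "J \<subseteq> I" for J
    using that psubset.hyps psubset.prems(1) finite_subset by blast
  consider "I = {}"
    | (tight) J where "J \<subset> I" "J \<noteq> {}" "card J = card (\<Union>(A ` J))"
    | (slack) "I \<noteq> {}" "\<And>J. J \<subset> I \<Longrightarrow> J \<noteq> {} \<Longrightarrow> card J < card (\<Union>(A ` J))"
    using psubset.prems(2) by (metis order_le_less psubset_imp_subset)
  then show ?case
  proof cases
    case 1
    then show ?thesis by simp
  next
    case tight
    define U where "U = \<Union>(A ` J)"
    have finU: "finite U" and finJ: "finite J"
      using fin_Un tight(1) psubset.hyps finite_subset by (auto simp: U_def)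
    obtain f where f: "inj_on f J" "\<forall>i\<in>J. f i \<in> A i"
    proof -
      have "\<exists>f. inj_on f J \<and> (\<forall>i\<in>J. f i \<in> A i)"
      proof (rule psubset.IH[OF tight(1)])
        show "finite (A i)" if "i \<in> J" for i
          using that tight(1) psubset.prems(1) by blast
        show "card K \<le> card (\<Union>(A ` K))" if "K \<subseteq> J" for K
          using that tight(1) by (intro psubset.prems(2)) auto
      qed
      then show ?thesis
        using that by blast
    qed
    have "\<exists>g. inj_on g (I - J) \<and> (\<forall>i\<in>I - J. g i \<in> A i - U)"
    proof (rule psubset.IH)
      show "I - J \<subset> I"
        using tight by auto
      show "finite (A i - U)" if "i \<in> I - J" for i
        using that psubset.prems(1) by simp
      show "card K \<le> card (\<Union>i\<in>K. A i - U)" if K: "K \<subseteq> I - J" for K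
      proof -
        have finK: "finite K"
          using K psubset.hyps finite_subset by blast
        \<comment> \<open>Hall's condition for \<open>J \<union> K\<close> passes to
          \<open>K\<close> outside \<open>U\<close>: since \<open>J\<close> is tight,
          \<open>card J\<close> and \<open>card U\<close> cancel.\<close>
        have "card J + card K = card (J \<union> K)"
          using K finJ finK by (subst card_Un_disjoint) auto
        also have "\<dots> \<le> card (\<Union>(A ` (J \<union> K)))"
          using K tight(1) by (intro psubset.prems(2)) auto
        also have "\<Union>(A ` (J \<union> K)) = U \<union> (\<Union>i\<in>K. A i - U)"
          by (auto simp: U_def)
        also have "card \<dots> \<le> card U + card (\<Union>i\<in>K. A i - U)"
          by (rule card_Un_le)
        finally show ?thesis
          using tight(3) by (simp add: U_def)
      qed
    qed
    then obtain g where g: "inj_on g (I - J)" "\<forall>i\<in>I - J. g i \<in> A i - U"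
      by blast
    define h where "h i = (if i \<in> J then f i else g i)" for i
    have hJ: "h i \<in> A i \<inter> U" if "i \<in> J" for i
      using that f(2) by (auto simp: h_def U_def)
    have hI: "h i \<in> A i - U" if "i \<in> I" "i \<notin> J" for i
      using that g(2) by (simp add: h_def)
    have "inj_on h I"
    proof (rule inj_onI)
      fix i j assume ij: "i \<in> I" "j \<in> I" "h i = h j"
      then have "i \<in> J \<longleftrightarrow> j \<in> J"
        using hJ[of i] hJ[of j] hI[of i] hI[of j] by auto
      then show "i = j"
        using ij f(1) g(1) by (cases "i \<in> J") (simp_all add: h_def inj_on_eq_iff)
    qed
    then show ?thesis
      using hJ hI by blast
  next
    case slack
    obtain i where i: "i \<in> I"
      using slack(1) by blast
    have "card {i} \<le> card (A i)"
      using psubset.prems(2)[of "{i}"] i by simp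
    then obtain x where x: "x \<in> A i"
      by (cases "A i = {}") auto
    have "\<exists>g. inj_on g (I - {i}) \<and> (\<forall>j\<in>I - {i}. g j \<in> A j - {x})"
    proof (rule psubset.IH)
      show "I - {i} \<subset> I"
        using i by auto
      show "finite (A j - {x})" if "j \<in> I - {i}" for j
        using that psubset.prems(1) by simp
      show "card K \<le> card (\<Union>j\<in>K. A j - {x})" if K: "K \<subseteq> I - {i}" for K
      proof (cases "K = {}")
        case False
        have "card K < card (\<Union>(A ` K))"
          using K i False by (intro slack(2)) auto
        \<comment> \<open>Deleting \<open>x\<close> loses at most one neighbour, which the strict
          inequality absorbs.\<close>
        moreover have "card (\<Union>(A ` K)) - 1 \<le> card (\<Union>(A ` K) - {x})"
          by (simp add: card_Diff_singleton_if)
        ultimately have "card K \<le> card (\<Union>(A ` K) - {x})"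
          by linarith
        moreover have "\<Union>(A ` K) - {x} = (\<Union>j\<in>K. A j - {x})"
          by blast
        ultimately show ?thesis by (simp only:)
      qed simp
    qed
    then obtain g where g: "inj_on g (I - {i})" "\<forall>j\<in>I - {i}. g j \<in> A j - {x}"
      by blast
    have "inj_on (g(i := x)) (insert i (I - {i}))"
      using g inj_on_fun_updI[of g "I - {i}" x i] by (simp only: inj_on_insert fun_upd_same) auto
    moreover have "\<forall>j\<in>I. (g(i := x)) j \<in> A j"
      using g(2) x by simp
    ultimately show ?thesis
      using i by (metis insert_Diff)
  qed
qed

text \<open>Double counting of the edges at \<open>J\<close>: there are at least
  \<open>r * card J\<close> of them, and each neighbour of \<open>J\<close> receives at most
  \<open>r\<close>, so Hall's condition holds.\<close>

corollary Hall_degree: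
  assumes "finite I" and "\<And>i. i \<in> I \<Longrightarrow> finite (A i)" and "r > 0"
    and left: "\<And>i. i \<in> I \<Longrightarrow> r \<le> card (A i)"
    and right: "\<And>i s. i \<in> I \<Longrightarrow> s \<in> A i \<Longrightarrow> card {j \<in> I. s \<in> A j} \<le> r"
  shows "\<exists>f. inj_on f I \<and> (\<forall>i\<in>I. f i \<in> A i)"
proof (rule Hall)
  fix J assume J: "J \<subseteq> I"
  let ?U = "\<Union>(A ` J)"
  have finJ: "finite J" and finU: "finite ?U"
    using J assms(1,2) finite_subset by blast+
  have "r * card J \<le> (\<Sum>i\<in>J. card (A i))"
    using left J sum_mono[of J "\<lambda>_. r" "\<lambda>i. card (A i)"] by (auto simp: mult.commute)
  also have "\<dots> = (\<Sum>i\<in>J. card {s \<in> ?U. s \<in> A i})"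
    by (intro sum.cong refl arg_cong[where f = card]) auto
  also have "\<dots> = (\<Sum>s\<in>?U. card {i \<in> J. s \<in> A i})"
    using finJ finU by (intro sum_multicount_gen) auto
  also have "\<dots> \<le> (\<Sum>s\<in>?U. r)"
  proof (rule sum_mono)
    fix s assume "s \<in> ?U"
    then obtain i where "i \<in> I" "s \<in> A i"
      using J by auto
    moreover have "card {i \<in> J. s \<in> A i} \<le> card {i \<in> I. s \<in> A i}"
      using J assms(1) by (intro card_mono) auto
    ultimately show "card {i \<in> J. s \<in> A i} \<le> r"
      using right le_trans by blast
  qed
  finally show "card J \<le> card ?U"
    using \<open>r > 0\<close> by (simp add: mult.commute)
qed (use assms in auto)

section \<open>Samples and matchings\<close>

text \<open>Over a finite \<open>X\<close>, the samples with which \<open>c\<close> is consistent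
  are exactly the \<open>graph_on c T\<close> with \<open>T \<subseteq> X\<close>, and
  \<open>T\<close> is recovered by projecting with \<open>fst\<close>.\<close>

definition graph_on :: "'a concept \<Rightarrow> 'a set \<Rightarrow> 'a sample" where
  "graph_on c T = (\<lambda>x. (x, c x)) ` T"

lemma mem_graph_on: "(x, b) \<in> graph_on c T \<longleftrightarrow> x \<in> T \<and> b = c x"
  by (auto simp: graph_on_def)

lemma fst_graph_on [simp]: "fst ` graph_on c T = T"
  by (force simp: graph_on_def)

lemma card_graph_on [simp]: "card (graph_on c T) = card T"
  by (simp add: graph_on_def card_image inj_on_def)

lemma consistent_graph_on: "consistent c (graph_on d T) \<longleftrightarrow> (\<forall>x\<in>T. c x = d x)"
  by (auto simp: consistent_def graph_on_def)

lemma graph_on_labeled_samples: "finite X \<Longrightarrow> T \<subseteq> X \<Longrightarrow> graph_on c T \<in> labeled_samples X"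
  by (auto simp: labeled_samples_def graph_on_def inj_on_def dest: finite_subset)

lemma finite_labeled_samples: "finite X \<Longrightarrow> finite (labeled_samples X)"
  by (rule finite_subset[of _ "Pow (X \<times> UNIV)"]) (auto simp: labeled_samples_def)

text \<open>A sample is coded by its set of points together with the set of points labeled
  \<open>True\<close>. The label function is written as membership in that set to fit the coding map
  of the counting lemma below.\<close>

lemma labeled_samples_eq_graph_on:
  assumes "S \<in> labeled_samples X"
  shows "S = graph_on (\<lambda>x. x \<in> {x. (x, True) \<in> S}) (fst ` S)"
proof -
  have uniq: "b = b'" if "(x, b) \<in> S" "(x, b') \<in> S" for x b b'
    using assms that inj_onD[of fst S "(x, b)" "(x, b')"] by (simp add: labeled_samples_def)
  have eq: "(x, b) \<in> S \<longleftrightarrow> x \<in> fst ` S \<and> b = ((x, True) \<in> S)" for x b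
  proof
    assume "(x, b) \<in> S"
    then show "x \<in> fst ` S \<and> b = ((x, True) \<in> S)"
      using uniq[of x b True] by (cases b) (auto intro: rev_image_eqI)
  next
    assume x: "x \<in> fst ` S \<and> b = ((x, True) \<in> S)"
    then obtain b' where "(x, b') \<in> S" by auto
    then show "(x, b) \<in> S"
      using x uniq[of x True b'] by (cases b; cases b') auto
  qed
  have "(x, b) \<in> S \<longleftrightarrow> (x, b) \<in> graph_on (\<lambda>x. x \<in> {x. (x, True) \<in> S}) (fst ` S)" for x b
    unfolding mem_graph_on mem_Collect_eq by (rule eq)
  then show ?thesis
    by (intro set_eqI) (metis surj_pair)
qed

text \<open>Every sample of size \<open>i\<close> arises from a set \<open>T\<close> of
  \<open>i\<close> points and a subset of \<open>T\<close> carrying the label \<open>True\<close>;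
  there are \<open>(card X choose i) * 2 ^ i\<close> such pairs.\<close>

lemma card_labeled_samples_le:
  assumes "finite X"
  shows "card {S \<in> labeled_samples X. card S \<le> d} \<le> (\<Sum>i\<le>d. (card X choose i) * 2 ^ i)"
proof -
  let ?T = "\<lambda>i. {T. T \<subseteq> X \<and> card T = i}"
  let ?g = "\<lambda>p. graph_on (\<lambda>x. x \<in> snd p) (fst p)"
  have finT: "finite (?T i)" for i
    using assms by (auto intro: finite_subset[of _ "Pow X"])
  have finP: "T \<in> ?T i \<Longrightarrow> finite (Pow T)" for T i
    using assms finite_subset by auto
  have "{S \<in> labeled_samples X. card S \<le> d} \<subseteq> (\<Union>i\<le>d. ?g ` Sigma (?T i) Pow)"
  proof
    fix S assume "S \<in> {S \<in> labeled_samples X. card S \<le> d}"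
    then have S: "S \<in> labeled_samples X" "card S \<le> d" by auto
    let ?p = "(fst ` S, {x. (x, True) \<in> S})"
    have "fst ` S \<in> ?T (card S)"
      using S by (auto simp: labeled_samples_def card_image)
    moreover have "{x. (x, True) \<in> S} \<subseteq> fst ` S"
      by (auto intro: rev_image_eqI)
    ultimately have "?p \<in> Sigma (?T (card S)) Pow" by auto
    moreover have "S = ?g ?p"
      using labeled_samples_eq_graph_on[OF S(1)] by simp
    ultimately have "S \<in> ?g ` Sigma (?T (card S)) Pow" by (rule rev_image_eqI)
    then show "S \<in> (\<Union>i\<le>d. ?g ` Sigma (?T i) Pow)"
      using S(2) by blast
  qed
  then have "card {S \<in> labeled_samples X. card S \<le> d} \<le> card (\<Union>i\<le>d. ?g ` Sigma (?T i) Pow)"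
    using finT finP by (intro card_mono finite_UN_I finite_imageI finite_SigmaI) auto
  also have "\<dots> \<le> (\<Sum>i\<le>d. card (?g ` Sigma (?T i) Pow))"
    by (rule card_UN_le) simp
  also have "\<dots> \<le> (\<Sum>i\<le>d. (card X choose i) * 2 ^ i)"
  proof (rule sum_mono)
    fix i
    have "card (?g ` Sigma (?T i) Pow) \<le> card (Sigma (?T i) Pow)"
      using finT finP by (intro card_image_le) auto
    also have "\<dots> = (\<Sum>T\<in>?T i. card (Pow T))"
      using finT finP by (intro card_SigmaI) auto
    also have "\<dots> = (\<Sum>T\<in>?T i. 2 ^ i)"
      using assms by (intro sum.cong) (auto simp: card_Pow dest: finite_subset)
    finally show "card (?g ` Sigma (?T i) Pow) \<le> (card X choose i) * 2 ^ i"
      using assms by (simp add: n_subsets)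
  qed
  finally show ?thesis .
qed

section \<open>Inequalities valid for every concept class\<close>

text \<open>\<open>M\<close> injects \<open>C\<close> into these samples. This gives
  \<open>SMN' \<le> SMN\<close> and also shows that the minimum defining \<open>SMN'\<close> is
  attained.\<close>

lemma card_le_card_realizable_cost:
  assumes "finite X" "finite C" "saturating_matching X C M"
  shows "card C \<le> card {S \<in> labeled_samples X. realizable C S \<and> card S \<le> cost C M}"
proof -
  have "M ` C \<subseteq> {S \<in> labeled_samples X. realizable C S \<and> card S \<le> cost C M}"
    using assms by (auto simp: saturating_matching_def realizable_def cost_def)
  then have "card (M ` C) \<le> card {S \<in> labeled_samples X. realizable C S \<and> card S \<le> cost C M}"
    using assms(1) by (intro card_mono) (auto simp: finite_labeled_samples)
  then show ?thesis
    using assms(3) by (simp add: saturating_matching_def card_image)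
qed

text \<open>Full graphs over \<open>X\<close> serve as samples: inclusion of two of them forces
  agreement on \<open>X\<close>, hence equality of the extensional concepts. The minima defining
  \<open>SMN\<close> and \<open>AMN\<close> are therefore attained.\<close>

lemma ex_antichain_matching:
  assumes "finite X" "C \<subseteq> X \<rightarrow>\<^sub>E UNIV"
  shows "\<exists>M. saturating_matching X C M \<and> antichain_property C M"
proof -
  have "c = c'" if "c \<in> C" "c' \<in> C" "graph_on c X \<subseteq> graph_on c' X" for c c'
    using that assms(2) by (intro PiE_ext[of c X _ c']) (auto simp: graph_on_def)
  then have "saturating_matching X C (\<lambda>c. graph_on c X) \<and> antichain_property C (\<lambda>c. graph_on c X)"
    using assms(1) by (auto simp: saturating_matching_def antichain_property_def inj_on_def
        consistent_graph_on graph_on_labeled_samples)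
  then show ?thesis by blast
qed

lemma SMN'_le_SMN:
  assumes "finite X" "C \<subseteq> X \<rightarrow>\<^sub>E UNIV"
  shows "SMN' X C \<le> SMN X C"
proof -
  have "finite C"
    using assms by (meson finite_PiE finite_class.finite_UNIV finite_subset)
  have "\<exists>d M. saturating_matching X C M \<and> cost C M = d"
    using ex_antichain_matching[OF assms] by blast
  then have "\<exists>M. saturating_matching X C M \<and> cost C M = SMN X C"
    unfolding SMN_def by (rule LeastI_ex)
  then obtain M where M: "saturating_matching X C M" "cost C M = SMN X C"
    by blast
  then show ?thesis
    using card_le_card_realizable_cost[OF assms(1) \<open>finite C\<close> M(1)] M(2)
    unfolding SMN'_def by (intro Least_le) simp
qed

lemma SMN_le_AMN:
  assumes "finite X" "C \<subseteq> X \<rightarrow>\<^sub>E UNIV"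
  shows "SMN X C \<le> AMN X C"
proof -
  have "\<exists>d M. saturating_matching X C M \<and> antichain_property C M \<and> cost C M = d"
    using ex_antichain_matching[OF assms] by blast
  then have "\<exists>M. saturating_matching X C M \<and> antichain_property C M \<and> cost C M = AMN X C"
    unfolding AMN_def by (rule LeastI_ex)
  then obtain M where M: "saturating_matching X C M" "cost C M = AMN X C"
    by blast
  then show ?thesis
    using M unfolding SMN_def by (intro Least_le) blast
qed

section \<open>The powerset class\<close>

text \<open>A concept that is prescribed on \<open>T\<close> is determined by its restriction to
  \<open>X - T\<close>.\<close>

lemma card_consistent_le:
  assumes "finite X" "T \<subseteq> X"
  shows "card {c \<in> powerset_class X. consistent c (graph_on d T)} \<le> 2 ^ (card X - card T)"
proof -
  let ?C = "{c \<in> powerset_class X. consistent c (graph_on d T)}"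
  have "inj_on (\<lambda>c. restrict c (X - T)) ?C"
  proof (rule inj_onI)
    fix c c' assume cc: "c \<in> ?C" "c' \<in> ?C" "restrict c (X - T) = restrict c' (X - T)"
    have "c x = c' x" if "x \<in> X" for x
    proof (cases "x \<in> T")
      case True
      then show ?thesis using cc by (simp add: consistent_graph_on)
    next
      case False
      then show ?thesis using that fun_cong[OF cc(3), of x] by simp
    qed
    then show "c = c'"
      using cc by (intro PiE_ext[of c X _ c']) (auto simp: powerset_class_def)
  qed
  then have "card ?C \<le> card ((X - T) \<rightarrow>\<^sub>E (UNIV :: bool set))"
    using assms(1) by (intro card_inj_on_le[where f = "\<lambda>c. restrict c (X - T)"] finite_PiE) auto
  also have "\<dots> = 2 ^ (card X - card T)"
    using assms by (simp add: card_PiE card_Diff_subset finite_subset)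
  finally show ?thesis .
qed

lemma card_powerset_class: "finite X \<Longrightarrow> card (powerset_class X) = 2 ^ card X"
  by (simp add: powerset_class_def card_PiE)

text \<open>The hypothesis is \<open>2 ^ n \<le> (n choose k) * 2 ^ k\<close> after division by
  \<open>2 ^ k\<close>, and compares the two degrees in Hall's theorem. For
  \<open>k > card X\<close> it would read \<open>1 \<le> 0\<close>, so truncated subtraction does no
  harm.\<close>

lemma AMN_powerset_class_le:
  assumes "finite X" and k: "2 ^ (card X - k) \<le> card X choose k"
  shows "AMN X (powerset_class X) \<le> k"
proof -
  let ?C = "powerset_class X"
  define A where "A c = graph_on c ` {T. T \<subseteq> X \<and> card T = k}" for c :: "'a concept"
  have finC: "finite ?C" and "?C \<noteq> {}"
    using assms(1) by (auto simp: powerset_class_def PiE_eq_empty_iff intro: finite_PiE)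
  have "\<exists>M. inj_on M ?C \<and> (\<forall>c\<in>?C. M c \<in> A c)"
  proof (rule Hall_degree[where r = "2 ^ (card X - k)"])
    fix c assume "c \<in> ?C"
    show "finite (A c)"
      using assms(1) by (auto simp: A_def)
    have "inj_on (graph_on c) {T. T \<subseteq> X \<and> card T = k}"
      by (rule inj_on_inverseI[where g = "image fst"]) simp
    then show "2 ^ (card X - k) \<le> card (A c)"
      using k assms(1) by (simp add: A_def card_image n_subsets)
  next
    fix c S assume "c \<in> ?C" "S \<in> A c"
    then obtain T where T: "T \<subseteq> X" "card T = k" "S = graph_on c T"
      by (auto simp: A_def)
    have "consistent c' (graph_on c T)" if S: "S \<in> A c'" for c'
    proof -
      obtain T' where T': "S = graph_on c' T'"
        using S by (auto simp: A_def)
      \<comment> \<open>Both graphs are the same sample \<open>S\<close>, so their projections to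
        \<open>X\<close> agree.\<close>
      have "T' = T"
        using arg_cong[OF T', of "image fst"] T(3) by simp
      then have "graph_on c T = graph_on c' T"
        using T' T(3) by simp
      then show ?thesis
        by (simp add: consistent_graph_on)
    qed
    then have "{c' \<in> ?C. S \<in> A c'} \<subseteq> {c' \<in> ?C. consistent c' (graph_on c T)}"
      by blast
    then have "card {c' \<in> ?C. S \<in> A c'} \<le> card {c' \<in> ?C. consistent c' (graph_on c T)}"
      using finC by (intro card_mono) auto
    also have "\<dots> \<le> 2 ^ (card X - k)"
      using card_consistent_le[OF assms(1) T(1)] T(2) by simp
    finally show "card {c' \<in> ?C. S \<in> A c'} \<le> 2 ^ (card X - k)" .
  qed (use finC in auto)
  then obtain M where inj: "inj_on M ?C" and M: "\<And>c. c \<in> ?C \<Longrightarrow> M c \<in> A c"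
    by blast
  have MT: "\<exists>T. T \<subseteq> X \<and> card T = k \<and> M c = graph_on c T" if "c \<in> ?C" for c
    using M[OF that] by (auto simp: A_def)
  have card_M: "card (M c) = k" if "c \<in> ?C" for c
    using MT[OF that] by auto
  have "M c \<in> labeled_samples X \<and> consistent c (M c)" if "c \<in> ?C" for c
    using MT[OF that] assms(1) by (auto simp: graph_on_labeled_samples consistent_graph_on)
  then have sat: "saturating_matching X ?C M"
    using inj by (auto simp: saturating_matching_def)
  have "c = c'" if "c \<in> ?C" "c' \<in> ?C" "M c \<subseteq> M c'" for c c'
  proof -
    have "finite (M c')"
      using sat that(2) by (auto simp: saturating_matching_def labeled_samples_def)
    \<comment> \<open>All matched samples have size \<open>k\<close>, so inclusion between two of
      them is equality.\<close>
    then have "M c = M c'"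
      using that card_M by (intro card_subset_eq) auto
    then show ?thesis
      using inj that by (auto dest: inj_onD)
  qed
  then have "antichain_property ?C M"
    by (auto simp: antichain_property_def)
  moreover have "(\<lambda>c. card (M c)) ` ?C = {k}"
    using card_M \<open>?C \<noteq> {}\<close> by auto
  then have "cost ?C M = k"
    by (simp add: cost_def)
  ultimately show ?thesis
    unfolding AMN_def using sat by (intro Least_le) blast
qed

section \<open>Binomial coefficients against powers of two\<close>

lemma binomial_ge_power2_step:
  assumes "2 ^ (n - k) \<le> n choose k" "k \<le> n"
  shows "(2::nat) ^ (n + 2 - (k + 1)) \<le> n + 2 choose (k + 1)"
proof -
  have "(2::nat) ^ (n + 2 - (k + 1)) = 2 * 2 ^ (n - k)"
    using assms(2) by (simp add: Suc_diff_le)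
  also have "\<dots> \<le> 2 * (n choose k)"
    using assms(1) by simp
  \<comment> \<open>Pascal's rule applied twice produces \<open>n choose k\<close> two
    times.\<close>
  also have "\<dots> \<le> n + 2 choose (k + 1)"
    by (cases k) auto
  finally show ?thesis .
qed

text \<open>Gives an antichain matching of cost strictly below \<open>n / 2\<close>. The induction
  advances by two, which raises \<open>(n - 1) div 2\<close> by one, so two base cases are checked:
  \<open>16 \<le> 35\<close> and \<open>32 \<le> 56\<close>. At \<open>n = 6\<close> the claim would
  be \<open>16 \<le> 15\<close>, whence the threshold 7.\<close>

lemma near_middle_binomial_ge_power2:
  assumes "n \<ge> 7"
  shows "(2::nat) ^ (n - (n - 1) div 2) \<le> n choose ((n - 1) div 2)"
  using assms
proof (induction n rule: less_induct)
  case (less n)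
  consider "n = 7" | "n = 8" | "n \<ge> 9"
    using less.prems by linarith
  then show ?case
  proof cases
    case 1
    have "(7::nat) choose 3 = 35"
      by (simp add: eval_nat_numeral)
    then show ?thesis using 1 by simp
  next
    case 2
    have "(8::nat) choose 3 = 56"
      by (simp add: eval_nat_numeral)
    then show ?thesis using 2 by simp
  next
    case 3
    define m where "m = n - 2"
    have n: "n = m + 2" "m < n" "m \<ge> 7"
      using 3 by (auto simp: m_def)
    moreover have "(n - 1) div 2 = (m - 1) div 2 + 1"
      using n by linarith
    ultimately show ?thesis
      using binomial_ge_power2_step[OF less.IH[of m]] by simp
  qed
qed

text \<open>Below the middle the binomial coefficients do not decrease, so the summands at least
  double, and a sum of such terms is at most the next term.\<close>

lemma sum_binomial_power2_le:
  assumes "2 * d < n"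
  shows "(\<Sum>i\<le>d. (n choose i) * 2 ^ i) \<le> (n choose Suc d) * 2 ^ Suc d"
proof -
  have step: "n choose i \<le> n choose Suc i" if "i \<le> d" for i
  proof -
    \<comment> \<open>\<open>Suc (n - Suc i)\<close> is \<open>n - i\<close>; the second fact
      restates \<open>2 * i < n\<close>.\<close>
    have n: "Suc (i + (n - Suc i)) = n" "Suc i \<le> Suc (n - Suc i)"
      using that assms by auto
    have "Suc i * (n choose i) \<le> Suc (n - Suc i) * (n choose i)"
      using n(2) by (rule mult_le_mono1)
    also have "\<dots> = Suc i * (n choose Suc i)"
      using Suc_times_binomial_add[of i "n - Suc i"] unfolding n(1) by simp
    finally show ?thesis
      by (simp only: Suc_mult_le_cancel1)
  qed
  show ?thesis
    using assms step
  proof (induction d)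
    case 0
    then show ?case by simp
  next
    case (Suc d)
    \<comment> \<open>By the induction hypothesis, the terms up to \<open>d\<close> together are at
      most the term at \<open>Suc d\<close>.\<close>
    have "(\<Sum>i\<le>Suc d. (n choose i) * 2 ^ i) \<le> 2 * ((n choose Suc d) * 2 ^ Suc d)"
      using Suc by simp
    also have "\<dots> \<le> (n choose Suc (Suc d)) * 2 ^ Suc (Suc d)"
      using Suc.prems(2)[of "Suc d"] by simp
    finally show ?case .
  qed
qed

section \<open>The upper bound on \<open>AMN\<close> in terms of \<open>SMN'\<close>\<close>

lemma AMN_powerset_class_le_Suc_SMN':
  assumes "finite X" "card X \<ge> 7"
  shows "AMN X (powerset_class X) \<le> Suc (SMN' X (powerset_class X))"
proof -
  let ?n = "card X" and ?C = "powerset_class X"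
  define d where "d = SMN' X ?C"
  have sub: "?C \<subseteq> X \<rightarrow>\<^sub>E UNIV"
    by (simp add: powerset_class_def)
  have finC: "finite ?C"
    using assms(1) by (auto simp: powerset_class_def intro: finite_PiE)
  \<comment> \<open>The doubling argument needs \<open>d\<close> below \<open>n / 2\<close>; this
    comes from the cruder bound on \<open>AMN\<close> near the middle.\<close>
  have "d \<le> AMN X ?C"
    using SMN'_le_SMN[OF assms(1) sub] SMN_le_AMN[OF assms(1) sub] by (simp add: d_def)
  also have "\<dots> \<le> (?n - 1) div 2"
    using near_middle_binomial_ge_power2[OF assms(2)] by (intro AMN_powerset_class_le assms(1))
  finally have d: "2 * d < ?n"
    using assms(2) by linarith
  \<comment> \<open>Any matching shows that some size bound is large enough, so the least one,
    \<open>d\<close>, satisfies the defining inequality of \<open>SMN'\<close>.\<close>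
  obtain M where "saturating_matching X ?C M"
    using ex_antichain_matching[OF assms(1) sub] by blast
  then have "card ?C \<le> card {S \<in> labeled_samples X. realizable ?C S \<and> card S \<le> d}"
    unfolding d_def SMN'_def
    using card_le_card_realizable_cost[OF assms(1) finC] by (intro LeastI) blast
  also have "\<dots> \<le> card {S \<in> labeled_samples X. card S \<le> d}"
    using assms(1) by (intro card_mono) (auto simp: finite_labeled_samples)
  also have "\<dots> \<le> (\<Sum>i\<le>d. (?n choose i) * 2 ^ i)"
    by (rule card_labeled_samples_le[OF assms(1)])
  also have "\<dots> \<le> (?n choose Suc d) * 2 ^ Suc d"
    by (rule sum_binomial_power2_le[OF d])
  finally have "2 ^ ?n \<le> (?n choose Suc d) * 2 ^ Suc d"
    by (simp only: card_powerset_class[OF assms(1)])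
  \<comment> \<open>Here \<open>Suc d \<le> ?n\<close>, so the subtraction is exact.\<close>
  moreover have "2 ^ ?n = 2 ^ (?n - Suc d) * (2 ^ Suc d :: nat)"
    using d by (simp flip: power_add power_Suc)
  ultimately have "2 ^ (?n - Suc d) * 2 ^ Suc d \<le> (?n choose Suc d) * 2 ^ Suc d"
    by (simp only:)
  then have "2 ^ (?n - Suc d) \<le> ?n choose Suc d"
    unfolding mult_le_cancel2 by simp
  then show ?thesis
    unfolding d_def by (intro AMN_powerset_class_le assms(1))
qed

theorem theorem6p1:
  "finite {n::nat. n \<ge> 1 \<and>
     \<not> (int (AMN {1..n} (powerset_class {1..n})) - 1 \<le> int (SMN' {1..n} (powerset_class {1..n}))
        \<and> SMN' {1..n} (powerset_class {1..n}) \<le> SMN {1..n} (powerset_class {1..n})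
        \<and> SMN {1..n} (powerset_class {1..n}) \<le> AMN {1..n} (powerset_class {1..n}))}"
\<comment> \<open>Every exception lies below 7, the threshold of the near-middle estimate.\<close>
proof (rule finite_subset)
  show "{n::nat. n \<ge> 1 \<and>
     \<not> (int (AMN {1..n} (powerset_class {1..n})) - 1 \<le> int (SMN' {1..n} (powerset_class {1..n}))
        \<and> SMN' {1..n} (powerset_class {1..n}) \<le> SMN {1..n} (powerset_class {1..n})
        \<and> SMN {1..n} (powerset_class {1..n}) \<le> AMN {1..n} (powerset_class {1..n}))} \<subseteq> {..<7}"
  proof (rule subsetI, rule ccontr)
    fix n :: nat
    assume "n \<notin> {..<7}"
    then have "AMN {1..n} (powerset_class {1..n}) \<le> Suc (SMN' {1..n} (powerset_class {1..n}))"
      by (intro AMN_powerset_class_le_Suc_SMN') auto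
    moreover have "SMN' {1..n} (powerset_class {1..n}) \<le> SMN {1..n} (powerset_class {1..n})"
      "SMN {1..n} (powerset_class {1..n}) \<le> AMN {1..n} (powerset_class {1..n})"
      by (auto intro!: SMN'_le_SMN SMN_le_AMN simp: powerset_class_def)
    moreover assume "n \<in> {n. n \<ge> 1 \<and>
     \<not> (int (AMN {1..n} (powerset_class {1..n})) - 1 \<le> int (SMN' {1..n} (powerset_class {1..n}))
        \<and> SMN' {1..n} (powerset_class {1..n}) \<le> SMN {1..n} (powerset_class {1..n})
        \<and> SMN {1..n} (powerset_class {1..n}) \<le> AMN {1..n} (powerset_class {1..n}))}"
    ultimately show False
      by auto
  qed
qed simp

end
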